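(* Let $n \geq 7$ and let $G$ be a $2$-geodetic digraph with order $n$ and maximal size (i.e. with $ex(n;2)$ arcs). Then $G$ is isomorphic to an orientation of $K_{\lceil \frac{n}{2} \rceil, \lfloor \frac{n}{2} \rfloor}$ in which all arcs are oriented in the same direction between the two partite sets, except for the arcs of a matching (possibly empty) that are oriented in the opposite direction. The number of isomorphism classes of such extremal digraphs is $n+1$ for odd $n \geq 7$ and $\frac{n}{2}+1$ for even $n \geq 8$.
   Context: A digraph has a vertex set and an arc set consisting of ordered pairs of distinct vertices. A walk of length $\ell$ is a sequence $x_0x_1\dots x_\ell$ of vertices with $x_i \rightarrow x_{i+1}$ for all $i$. A digraph is $k$-geodetic if for every ordered pair $(u,v)$ of (not necessarily distinct) vertices there is at most one $u,v$-walk of length at most $k$. For $n,k\ge 2$, $ex(n;k)$ is the largest possible number of arcs of a $k$-geodetic digraph on $n$ vertices. Order = number of vertices, size = number of arcs. *)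

theory Defs
  imports "Graph_Theory.Graph_Theory"
begin

text \<open>Digraphs are values of type \<open>'a pair_pre_digraph\<close> satisfying the locale predicate
  \<open>pair_digraph\<close>: finite, with arcs that are ordered pairs of distinct vertices. A walk of length
  \<open>l\<close> is a nonempty list of \<open>l + 1\<close> vertices (\<open>vwalk\<close>); one-vertex walks have length 0.\<close>

definition k_geodetic :: "nat \<Rightarrow> 'a pair_pre_digraph \<Rightarrow> bool" where
  "k_geodetic k G \<longleftrightarrow> (\<forall>u \<in> pverts G. \<forall>v \<in> pverts G.
     \<exists>\<^sub>\<le>\<^sub>1 p. vwalk p (with_proj G) \<and> hd p = u \<and> last p = v \<and> vwalk_length p \<le> k)"

text \<open>Every finite digraph has an isomorphic copy on natural numbers, so fixing the vertex type
  here does not affect the maximum.\<close>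

definition ex_geodetic :: "nat \<Rightarrow> nat \<Rightarrow> nat" where
  "ex_geodetic n k = Max {card (parcs G) | G :: nat pair_pre_digraph.
     pair_digraph G \<and> card (pverts G) = n \<and> k_geodetic k G}"

lemma ex_geodetic_set_finite_nonempty:
  defines "S n k \<equiv> {card (parcs G) | G :: nat pair_pre_digraph.
     pair_digraph G \<and> card (pverts G) = n \<and> k_geodetic k G}"
  shows "finite (S n k)" and "S n k \<noteq> {}"
proof -
  have "S n k \<subseteq> {..n * n}"
  proof
    fix m assume "m \<in> S n k"
    then obtain G :: "nat pair_pre_digraph" where
      G: "m = card (parcs G)" "pair_digraph G" "card (pverts G) = n"
      unfolding S_def by blast
    interpret pair_digraph G by (fact G(2))
    have "parcs G \<subseteq> pverts G \<times> pverts G" by (auto dest: wellformed')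
    then have "card (parcs G) \<le> card (pverts G \<times> pverts G)"
      by (intro card_mono) (auto simp: pair_finite_verts)
    then show "m \<in> {..n * n}" using G by (simp add: card_cartesian_product)
  qed
  then show "finite (S n k)" by (rule finite_subset) simp
next
  let ?G = "\<lparr>pverts = {..<n}, parcs = {}\<rparr>"
  have "p = [hd p]" if "vwalk p (with_proj ?G)" for p
    using that by (cases p rule: vwalk_arcs.cases) (auto simp: vwalk_def)
  then have "k_geodetic k ?G" unfolding k_geodetic_def Uniq_def by metis
  moreover have "pair_digraph ?G" by unfold_locales auto
  moreover have "card (pverts ?G) = n" by simp
  ultimately show "S n k \<noteq> {}" unfolding S_def by blast
qed

definition extremal_geodetic :: "nat \<Rightarrow> nat \<Rightarrow> 'a pair_pre_digraph \<Rightarrow> bool" where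
  "extremal_geodetic n k G \<longleftrightarrow> pair_digraph G \<and> card (pverts G) = n \<and> k_geodetic k G
     \<and> card (parcs G) = ex_geodetic n k"

text \<open>As in the library, an undirected graph is a symmetric digraph: each edge is a pair of opposite
  arcs, and an orientation keeps exactly one of them.\<close>

definition orientation :: "'a pair_pre_digraph \<Rightarrow> 'a pair_pre_digraph \<Rightarrow> bool" where
  "orientation D K \<longleftrightarrow> pverts D = pverts K \<and> parcs D \<subseteq> parcs K
     \<and> (\<forall>(u, v) \<in> parcs K. (u, v) \<in> parcs D \<longleftrightarrow> (v, u) \<notin> parcs D)"

definition partite_sets :: "'a set \<Rightarrow> 'a set \<Rightarrow> 'a pair_pre_digraph \<Rightarrow> bool" where
  "partite_sets S T K \<longleftrightarrow> pverts K = S \<union> T \<and> S \<inter> T = {} \<and> parcs K \<subseteq> S \<times> T \<union> T \<times> S"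

definition arc_matching :: "('a \<times> 'a) set \<Rightarrow> bool" where
  "arc_matching M \<longleftrightarrow> pairwise (\<lambda>e f. disjnt {fst e, snd e} {fst f, snd f}) M"

text \<open>\<open>(S, T)\<close> lists the two partite sets in either order, so the common direction may
  lead from the part of size \<open>a\<close> to the part of size \<open>b\<close> or the other way.\<close>

definition unidirectional_up_to_matching :: "nat \<Rightarrow> nat \<Rightarrow> 'a pair_pre_digraph \<Rightarrow> bool" where
  "unidirectional_up_to_matching a b D \<longleftrightarrow>
     (\<exists>K S T M. complete_bipartite_digraph a b (with_proj K) \<and> orientation D K
        \<and> partite_sets S T K
        \<and> M \<subseteq> parcs D \<and> arc_matching M \<and> M \<subseteq> T \<times> S \<and> parcs D - M \<subseteq> S \<times> T)"

definition iso_classes :: "nat pair_pre_digraph set \<Rightarrow> nat pair_pre_digraph set set" where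
  "iso_classes A = A // {(G, H). G \<in> A \<and> H \<in> A \<and> digraph_iso (with_proj G) (with_proj H)}"

end

theory Submission
  imports Defs
begin

text \<open>A triangle of a 2-geodetic digraph is directed, and every further vertex has at most one
  neighbour on it. Deleting a triangle from a digraph on \<open>n\<close> vertices therefore removes at most \<open>n\<close>
  arcs, so by induction a digraph with a triangle has fewer than \<open>n\<^sup>2 div 4\<close> arcs once
  \<open>n \<ge> 7\<close>. Without triangles, summing the degrees outside the neighbourhood of a vertex of maximal
  degree gives Mantel's bound and, in the case of equality, the balanced complete bipartite graph.
  Counting 2-walks between vertices of the same part then leaves only a matching of reversed
  arcs. Such a digraph is determined up to isomorphism by the size \<open>s\<close> of the source part and the
  number \<open>j\<close> of reversed arcs.\<close>

section \<open>Arc sets of 2-geodetic digraphs\<close>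

text \<open>Stated for bare relations, so that it passes to subsets when vertices are deleted. The
  conjuncts forbid a loop, then a 2-walk parallel to a trivial walk or to an arc, then two 2-walks
  with the same ends.\<close>

definition two_geo :: "'a rel \<Rightarrow> bool" where
  "two_geo A \<longleftrightarrow> irrefl A \<and> (\<forall>u v w. (u, v) \<in> A \<longrightarrow> (v, w) \<in> A \<longrightarrow> u \<noteq> w \<and> (u, w) \<notin> A)
     \<and> (\<forall>u v v' w. (u, v) \<in> A \<longrightarrow> (v, w) \<in> A \<longrightarrow> (u, v') \<in> A \<longrightarrow> (v', w) \<in> A \<longrightarrow> v = v')"

lemma two_geo_irrefl: "two_geo A \<Longrightarrow> (u, u) \<notin> A"
  and two_geo_antisym: "two_geo A \<Longrightarrow> (u, v) \<in> A \<Longrightarrow> (v, u) \<notin> A"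
  and two_geo_intrans: "two_geo A \<Longrightarrow> (u, v) \<in> A \<Longrightarrow> (v, w) \<in> A \<Longrightarrow> (u, w) \<notin> A"
  and two_geo_unique: "two_geo A \<Longrightarrow> (u, v) \<in> A \<Longrightarrow> (v, w) \<in> A \<Longrightarrow> (u, v') \<in> A \<Longrightarrow> (v', w) \<in> A \<Longrightarrow> v = v'"
  unfolding two_geo_def irrefl_def by metis+

lemma two_geo_subset: "two_geo A \<Longrightarrow> B \<subseteq> A \<Longrightarrow> two_geo B"
  unfolding two_geo_def irrefl_def subset_iff by metis

text \<open>A walk of length at most 2 is a list of one, two or three vertices. Comparing two such
  lists with equal ends gives nine cases, each settled by a single condition of
  \<open>two_geo\<close> or by the ends alone.\<close>

lemma k_geodetic_2_iff:
  assumes "pair_digraph G"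
  shows "k_geodetic 2 G \<longleftrightarrow> two_geo (parcs G)"
proof -
  interpret pair_digraph G by fact
  let ?w = "\<lambda>p. vwalk p (with_proj G) \<and> vwalk_length p \<le> 2"
  have w1: "?w [u]" if "u \<in> pverts G" for u
    using that by (auto simp: vwalk_def)
  have w2: "?w [u, v]" if "(u, v) \<in> parcs G" for u v
    using that by (auto simp: vwalk_def dest: wellformed')
  have w3: "?w [u, v, w]" if "(u, v) \<in> parcs G" "(v, w) \<in> parcs G" for u v w
    using that by (auto simp: vwalk_def dest: wellformed')
  have wE: "(\<exists>u. p = [u]) \<or> (\<exists>u v. p = [u, v] \<and> (u, v) \<in> parcs G)
      \<or> (\<exists>u v w. p = [u, v, w] \<and> (u, v) \<in> parcs G \<and> (v, w) \<in> parcs G)" if "?w p" for p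
  proof -
    have "length p \<noteq> 0" "length p \<le> 3" using that by (auto simp: vwalk_def)
    then have "length p = 1 \<or> length p = 2 \<or> length p = 3" by linarith
    then show ?thesis
      using that by (auto simp: vwalk_def length_Suc_conv numeral_2_eq_2 numeral_3_eq_3)
  qed
  have irr: "(u, u) \<notin> parcs G" for u
    using pair_no_loops[of "(u, u)"] by auto
  have "k_geodetic 2 G \<longleftrightarrow> (\<forall>p q. ?w p \<longrightarrow> ?w q \<longrightarrow> hd p = hd q \<longrightarrow> last p = last q \<longrightarrow> p = q)"
    (is "_ \<longleftrightarrow> ?U")
  proof -
    have inV: "hd p \<in> pverts G \<and> last p \<in> pverts G" if "?w p" for p
      using that by (auto simp: vwalk_def)
    then have "k_geodetic 2 G" if ?U
      using that unfolding k_geodetic_def Uniq_def by simp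
    moreover have ?U if G: "k_geodetic 2 G"
    proof (intro allI impI)
      fix p q assume *: "?w p" "?w q" "hd p = hd q" "last p = last q"
      then have "hd p \<in> pverts G" "last p \<in> pverts G" using inV by blast+
      then have "\<exists>\<^sub>\<le>\<^sub>1 r. vwalk r (with_proj G) \<and> hd r = hd p \<and> last r = last p \<and> vwalk_length r \<le> 2"
        using G unfolding k_geodetic_def by blast
      then show "p = q" by (rule Uniq_D) (use * in simp_all)
    qed
    ultimately show ?thesis by blast
  qed
  also have "?U \<longleftrightarrow> two_geo (parcs G)"
  proof
    assume U: ?U
    have "u \<noteq> w \<and> (u, w) \<notin> parcs G" if "(u, v) \<in> parcs G" "(v, w) \<in> parcs G" for u v w
      using U[rule_format, OF w3[OF that] w1[of u]] U[rule_format, OF w3[OF that] w2[of u w]] that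
      by (auto dest: wellformed')
    moreover have "v = v'" if "(u, v) \<in> parcs G" "(v, w) \<in> parcs G" "(u, v') \<in> parcs G" "(v', w) \<in> parcs G"
      for u v v' w
      using U[rule_format, OF w3[OF that(1,2)] w3[OF that(3,4)]] by simp
    ultimately show "two_geo (parcs G)" unfolding two_geo_def irrefl_def using irr by blast
  next
    assume T: "two_geo (parcs G)"
    show ?U
    proof (intro allI impI)
      fix p q assume *: "?w p" "?w q" "hd p = hd q" "last p = last q"
      show "p = q" using wE[OF *(1)]
      proof (elim disjE exE conjE)
        fix a assume p: "p = [a]"
        show ?thesis using wE[OF *(2)]
        proof (elim disjE exE conjE)
          fix a' assume q: "q = [a']"
          then show ?thesis using p *(3,4) by auto
        next
          fix a' b' assume q: "q = [a', b']" "(a', b') \<in> parcs G"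
          then show ?thesis using p *(3,4) irr by auto
        next
          fix a' b' c' assume q: "q = [a', b', c']" "(a', b') \<in> parcs G" "(b', c') \<in> parcs G"
          then show ?thesis using p *(3,4) two_geo_antisym[OF T q(2)] by auto
        qed
      next
        fix a b assume p: "p = [a, b]" "(a, b) \<in> parcs G"
        show ?thesis using wE[OF *(2)]
        proof (elim disjE exE conjE)
          fix a' assume q: "q = [a']"
          then show ?thesis using p *(3,4) irr by auto
        next
          fix a' b' assume q: "q = [a', b']" "(a', b') \<in> parcs G"
          then show ?thesis using p *(3,4) by auto
        next
          fix a' b' c' assume q: "q = [a', b', c']" "(a', b') \<in> parcs G" "(b', c') \<in> parcs G"
          then show ?thesis using p *(3,4) two_geo_intrans[OF T q(2,3)] by auto
        qed
      next
        fix a b c assume p: "p = [a, b, c]" "(a, b) \<in> parcs G" "(b, c) \<in> parcs G"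
        show ?thesis using wE[OF *(2)]
        proof (elim disjE exE conjE)
          fix a' assume q: "q = [a']"
          then show ?thesis using p *(3,4) two_geo_antisym[OF T p(2)] by auto
        next
          fix a' b' assume q: "q = [a', b']" "(a', b') \<in> parcs G"
          then show ?thesis using p *(3,4) two_geo_intrans[OF T p(2,3)] by auto
        next
          fix a' b' c' assume q: "q = [a', b', c']" "(a', b') \<in> parcs G" "(b', c') \<in> parcs G"
          then show ?thesis using p *(3,4) two_geo_unique[OF T p(2,3), of b'] by auto
        qed
      qed
    qed
  qed
  finally show ?thesis .
qed

section \<open>The extremal number and the underlying graph\<close>

definition directed_triangle :: "'a rel \<Rightarrow> 'a \<Rightarrow> 'a \<Rightarrow> 'a \<Rightarrow> bool" where
  "directed_triangle A x y z \<longleftrightarrow> (x, y) \<in> A \<and> (y, z) \<in> A \<and> (z, x) \<in> A"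

lemma directed_triangle_rotate: "directed_triangle A x y z \<Longrightarrow> directed_triangle A y z x"
  unfolding directed_triangle_def by blast

text \<open>Three of the four orientations of the two arcs at \<open>v\<close> put an arc parallel
  to a 2-walk on \<open>x\<close>, \<open>y\<close>, \<open>v\<close>. The fourth is the 2-walk from
  \<open>y\<close> over \<open>v\<close> to \<open>x\<close>, parallel to the one over
  \<open>z\<close>; only here does \<open>v \<noteq> z\<close> enter.\<close>

lemma no_two_neighbours_in_triangle:
  assumes "two_geo A" "directed_triangle A x y z" "v \<noteq> z"
    and "(x, v) \<in> A \<or> (v, x) \<in> A" "(y, v) \<in> A \<or> (v, y) \<in> A"
  shows False
  using assms two_geo_irrefl[OF assms(1)] two_geo_antisym[OF assms(1)]
    two_geo_intrans[OF assms(1)] two_geo_unique[OF assms(1)]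
  unfolding directed_triangle_def by metis

text \<open>Three arcs lie inside the triangle and each vertex of \<open>W\<close> is on at most one
  arc meeting it, so at most \<open>card W + 3 = card V\<close> arcs are lost.\<close>

lemma card_arcs_remove_triangle:
  assumes fin: "finite V" and sub: "A \<subseteq> V \<times> V" and geo: "two_geo A"
    and tri: "directed_triangle A x y z"
  defines "W \<equiv> V - {x, y, z}"
  shows "card V = card W + 3" and "card A \<le> card V + card (A \<inter> W \<times> W)"
proof -
  let ?D = "{x, y, z}"
  have xyz: "(x, y) \<in> A" "(y, z) \<in> A" "(z, x) \<in> A"
    using tri by (auto simp: directed_triangle_def)
  then have ne: "x \<noteq> y" "y \<noteq> z" "x \<noteq> z" and inV: "?D \<subseteq> V"
    using two_geo_irrefl[OF geo] sub by auto
  have cardD: "card ?D = 3" using ne by simp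
  have finW: "finite W" using fin by (simp add: W_def)
  have "card ?D \<le> card V" using fin inV by (rule card_mono)
  then show cardV: "card V = card W + 3"
    using fin inV cardD by (simp add: W_def card_Diff_subset)
  let ?B = "A \<inter> (W \<times> ?D \<union> ?D \<times> W)"
  \<comment> \<open>The end in \<open>W\<close> of an arc between \<open>W\<close> and the triangle;
    \<open>once\<close> makes this injective on \<open>?B\<close>.\<close>
  let ?f = "\<lambda>e. if fst e \<in> W then fst e else snd e"
  have once: "d = d'" if "d \<in> ?D" "d' \<in> ?D" "v \<in> W"
      "(d, v) \<in> A \<or> (v, d) \<in> A" "(d', v) \<in> A \<or> (v, d') \<in> A" for d d' v
  proof -
    have "v \<noteq> x" "v \<noteq> y" "v \<noteq> z" using that by (auto simp: W_def)
    \<comment> \<open>The three rotations of the triangle cover its three pairs of vertices.\<close>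
    note no = no_two_neighbours_in_triangle[OF geo tri \<open>v \<noteq> z\<close>]
      no_two_neighbours_in_triangle[OF geo directed_triangle_rotate[OF tri] \<open>v \<noteq> x\<close>]
      no_two_neighbours_in_triangle[OF geo directed_triangle_rotate[OF directed_triangle_rotate[OF tri]] \<open>v \<noteq> y\<close>]
    show ?thesis using that no by blast
  qed
  have "inj_on ?f ?B"
  proof (rule inj_onI)
    fix e e' assume e: "e \<in> ?B" "e' \<in> ?B" "?f e = ?f e'"
    obtain a b a' b' where ab: "e = (a, b)" "e' = (a', b')" by (cases e, cases e')
    have disj: "W \<inter> ?D = {}" by (auto simp: W_def)
    from e ab disj have "a = a' \<and> a \<in> W \<and> b \<in> ?D \<and> b' \<in> ?D \<or> b = b' \<and> b \<in> W \<and> a \<in> ?D \<and> a' \<in> ?D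
        \<or> a = b' \<and> a \<in> W \<and> b \<in> ?D \<and> a' \<in> ?D \<or> b = a' \<and> b \<in> W \<and> a \<in> ?D \<and> b' \<in> ?D"
      by (auto split: if_splits)
    then show "e = e'" using once e ab two_geo_antisym[OF geo] by (metis IntD1)
  qed
  moreover have "?f ` ?B \<subseteq> W" by (auto simp: W_def)
  ultimately have cB: "card ?B \<le> card W" using finW card_inj_on_le by blast
  have "A \<subseteq> A \<inter> W \<times> W \<union> ?B \<union> {(x, y), (y, z), (z, x)}"
  proof
    fix e assume e: "e \<in> A"
    obtain a b where ab: "e = (a, b)" by (cases e)
    then have "a \<in> V" "b \<in> V" using e sub by auto
    then have "a \<in> W \<or> a \<in> ?D" "b \<in> W \<or> b \<in> ?D" by (auto simp: W_def)
    moreover have "e \<in> {(x, y), (y, z), (z, x)}" if "a \<in> ?D" "b \<in> ?D"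
      using that e ab xyz two_geo_irrefl[OF geo] two_geo_antisym[OF geo] by blast
    ultimately show "e \<in> A \<inter> W \<times> W \<union> ?B \<union> {(x, y), (y, z), (z, x)}"
      using e ab by blast
  qed
  moreover have finA: "finite A" using fin sub by (meson finite_SigmaI finite_subset)
  ultimately have "card A \<le> card (A \<inter> W \<times> W \<union> ?B \<union> {(x, y), (y, z), (z, x)})"
    by (intro card_mono) auto
  also have "\<dots> \<le> card (A \<inter> W \<times> W) + card ?B + card {(x, y), (y, z), (z, x)}"
    by (meson add_le_mono1 card_Un_le order_trans)
  also have "card {(x, y), (y, z), (z, x)} = 3" using ne by simp
  finally show "card A \<le> card V + card (A \<inter> W \<times> W)" using cB cardV by simp
qed

text \<open>Both claims rest on the chain \<open>card A \<le> card F \<le> card S * card T\<close>,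
  whose last term is at most a quarter of the squared order; for the second claim every term is
  equal.\<close>

lemma mantel:
  assumes fin: "finite V" and sub: "A \<subseteq> V \<times> V" and geo: "two_geo A"
    and tri: "\<And>x y z. \<not> directed_triangle A x y z"
  shows "4 * card A \<le> (card V)\<^sup>2"
    and "card A = (card V)\<^sup>2 div 4 \<Longrightarrow>
      \<exists>X Y. V = X \<union> Y \<and> X \<inter> Y = {} \<and> card X * card Y = card A \<and> A \<union> A\<inverse> = X \<times> Y \<union> Y \<times> X"
proof -
  define N where "N v = {u. (u, v) \<in> A \<or> (v, u) \<in> A}" for v
  have NV: "N v \<subseteq> V" for v using sub by (auto simp: N_def)
  have finN: "finite (N v)" for v using NV fin finite_subset by blast
  have finA: "finite A" using fin sub by (meson finite_SigmaI finite_subset)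
  have main: "4 * card A \<le> (card V)\<^sup>2 \<and> (card A = (card V)\<^sup>2 div 4 \<longrightarrow>
      (\<exists>X Y. V = X \<union> Y \<and> X \<inter> Y = {} \<and> card X * card Y = card A \<and> A \<union> A\<inverse> = X \<times> Y \<union> Y \<times> X))"
  proof (cases "V = {}")
    case True
    then show ?thesis using sub by auto
  next
    case False
    have "Max ((\<lambda>u. card (N u)) ` V) \<in> (\<lambda>u. card (N u)) ` V"
      using False fin by (intro Max_in) auto
    then obtain v where v: "v \<in> V" and vmax: "Max ((\<lambda>u. card (N u)) ` V) = card (N v)"
      by (rule imageE)
    have max: "card (N u) \<le> card (N v)" if "u \<in> V" for u
      using fin that Max_ge[of "(\<lambda>u. card (N u)) ` V" "card (N u)"] unfolding vmax by blast
    define S where "S = N v"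
    define T where "T = V - S"
    have SV: "S \<subseteq> V" using NV S_def by simp
    have finS: "finite S" "finite T" using fin SV finite_subset by (auto simp: T_def)
    have cV: "card V = card S + card T"
      using fin SV by (simp add: T_def card_Diff_subset card_mono finite_subset)
    \<comment> \<open>Two adjacent vertices of \<open>S\<close> would form a triangle with
      \<open>v\<close>. A directed one is excluded by \<open>tri\<close>, any other has an arc
      parallel to a 2-walk.\<close>
    have indS: "(a, b) \<notin> A" if "a \<in> S" "b \<in> S" for a b
      using that tri two_geo_antisym[OF geo] two_geo_intrans[OF geo]
      unfolding S_def N_def directed_triangle_def mem_Collect_eq by metis
    \<comment> \<open>Every arc has an end in \<open>T\<close>. Turning the arcs of
      \<open>A2\<close> round makes all arcs start in \<open>T\<close>, which embeds
      \<open>A\<close> into the pairs of a vertex of \<open>T\<close> and a neighbour of it.\<close>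
    define F where "F = Sigma T N"
    define A1 where "A1 = A \<inter> T \<times> V"
    define A2 where "A2 = A \<inter> S \<times> T"
    have A12: "A = A1 \<union> A2" "A1 \<inter> A2 = {}"
      using sub indS by (auto simp: A1_def A2_def T_def)
    have dis: "A1 \<inter> A2\<inverse> = {}" using two_geo_antisym[OF geo] by (auto simp: A1_def A2_def)
    have F12: "A1 \<union> A2\<inverse> \<subseteq> F" by (auto simp: A1_def A2_def F_def N_def)
    have finF: "finite F" using finS finN by (simp add: F_def)
    have "card A = card A1 + card A2"
      using A12 finA by (metis card_Un_disjoint finite_Un)
    also have "\<dots> = card (A1 \<union> A2\<inverse>)"
      using dis A12 finA by (metis card_Un_disjoint card_inverse finite_Un finite_converse)
    finally have cA: "card A = card (A1 \<union> A2\<inverse>)" .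
    have "card A \<le> card F" using cA F12 finF card_mono by metis
    have cF: "card F = (\<Sum>u\<in>T. card (N u))"
      using finS finN by (simp add: F_def)
    also have "\<dots> \<le> (\<Sum>u\<in>T. card S)"
      by (rule sum_mono) (use max S_def T_def in auto)
    finally have cF2: "card F \<le> card S * card T" by (simp add: mult.commute)
    have "4 * (card S * card T) \<le> (card S + card T)\<^sup>2"
    proof -
      have "0 \<le> (int (card S) - int (card T))\<^sup>2" by simp
      then have "int (4 * (card S * card T)) \<le> int ((card S + card T)\<^sup>2)"
        by (simp add: power2_eq_square algebra_simps)
      then show ?thesis by linarith
    qed
    then have st: "4 * (card S * card T) \<le> (card V)\<^sup>2" using cV by simp
    have "4 * card A \<le> (card V)\<^sup>2" using \<open>card A \<le> card F\<close> cF2 st by linarith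
    moreover have "\<exists>X Y. V = X \<union> Y \<and> X \<inter> Y = {} \<and> card X * card Y = card A \<and> A \<union> A\<inverse> = X \<times> Y \<union> Y \<times> X"
      if eq: "card A = (card V)\<^sup>2 div 4"
    proof (intro exI conjI)
      have e1: "card A = card F" and e2: "card F = card S * card T"
        using eq st \<open>card A \<le> card F\<close> cF2 by linarith+
      show "V = S \<union> T" "S \<inter> T = {}" using SV by (auto simp: T_def)
      show "card S * card T = card A" using e1 e2 by simp
      have "A1 \<union> A2\<inverse> = F" using cA e1 F12 finF card_subset_eq by metis
      \<comment> \<open>An arc inside \<open>T\<close> contributes both of its directions to
        \<open>F\<close> but only one to \<open>A1\<close>, so equality leaves none.\<close>
      then have indT: "(a, b) \<notin> A" if "a \<in> T" "b \<in> T" for a b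
        using that two_geo_antisym[OF geo, of a b]
        unfolding F_def N_def A1_def A2_def T_def by blast
      have NT: "N u = S" if u: "u \<in> T" for u
      proof -
        have "N u \<subseteq> S" using u indT NV[of u] by (auto simp: N_def T_def)
        \<comment> \<open>The degrees over \<open>T\<close> are at most \<open>card S\<close> and
          sum to \<open>card S * card T\<close>, so none can be smaller.\<close>
        moreover have "card (N u) = card S"
        proof (rule ccontr)
          assume "card (N u) \<noteq> card S"
          moreover have "card (N w) \<le> card S" if "w \<in> T" for w using max that by (simp add: S_def T_def)
          ultimately have "(\<Sum>u\<in>T. card (N u)) < (\<Sum>u\<in>T. card S)"
            using u finS by (intro sum_strict_mono_ex1) (auto intro!: bexI[of _ u] simp: le_neq_implies_less)
          then show False using cF e2 by (simp add: mult.commute)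
        qed
        ultimately show ?thesis using finS card_subset_eq by metis
      qed
      show "A \<union> A\<inverse> = S \<times> T \<union> T \<times> S"
      proof -
        have "(a, b) \<in> A \<union> A\<inverse> \<longleftrightarrow> (a, b) \<in> S \<times> T \<union> T \<times> S" for a b
        proof -
          have "(a, b) \<in> A \<union> A\<inverse> \<Longrightarrow> a \<in> V \<and> b \<in> V" using sub by auto
          moreover have "a \<in> T \<Longrightarrow> (a, b) \<in> A \<union> A\<inverse> \<longleftrightarrow> b \<in> S" using NT[of a] by (auto simp: N_def)
          moreover have "b \<in> T \<Longrightarrow> (a, b) \<in> A \<union> A\<inverse> \<longleftrightarrow> a \<in> S" using NT[of b] by (auto simp: N_def)
          moreover have "a \<in> V \<longleftrightarrow> a \<in> S \<or> a \<in> T" "b \<in> V \<longleftrightarrow> b \<in> S \<or> b \<in> T"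
              "a \<notin> S \<or> a \<notin> T" "b \<notin> S \<or> b \<notin> T"
            using SV by (auto simp: T_def)
          moreover have "a \<in> S \<Longrightarrow> b \<in> S \<Longrightarrow> (a, b) \<notin> A \<union> A\<inverse>" using indS by blast
          ultimately show ?thesis unfolding Un_iff mem_Sigma_iff by argo
        qed
        then show ?thesis by (intro set_eqI) (metis surj_pair)
      qed
    qed
    ultimately show ?thesis by blast
  qed
  show "4 * card A \<le> (card V)\<^sup>2" using main by blast
  show "\<exists>X Y. V = X \<union> Y \<and> X \<inter> Y = {} \<and> card X * card Y = card A \<and> A \<union> A\<inverse> = X \<times> Y \<union> Y \<times> X"
    if "card A = (card V)\<^sup>2 div 4" using main that by blast
qed

text \<open>The directed triangle is the only 2-geodetic digraph beating the bound of Mantel's theorem.\<close>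

lemma card_arcs_le:
  assumes "finite V" "A \<subseteq> V \<times> V" "two_geo A"
  shows "4 * card A \<le> (card V)\<^sup>2 + (if card V = 3 then 3 else 0)"
  using assms
proof (induction "card V" arbitrary: V A rule: less_induct)
  case less
  show ?case
  proof (cases "\<exists>x y z. directed_triangle A x y z")
    case False
    then show ?thesis using mantel(1)[OF less.prems] by fastforce
  next
    case True
    then obtain x y z where tri: "directed_triangle A x y z" by blast
    let ?W = "V - {x, y, z}"
    note rem = card_arcs_remove_triangle[OF less.prems tri]
    define m where "m = card ?W"
    have "4 * card (A \<inter> ?W \<times> ?W) \<le> m\<^sup>2 + (if m = 3 then 3 else 0)"
      unfolding m_def using less.prems rem(1)
      by (intro less.hyps) (auto intro: two_geo_subset)
    moreover have V: "card V = m + 3" using rem(1) m_def by simp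
    moreover have "card A \<le> m + 3 + card (A \<inter> ?W \<times> ?W)" using rem(2) V by simp
    moreover have "(m + 3)\<^sup>2 = m\<^sup>2 + 6 * m + 9" by (simp add: power2_eq_square algebra_simps)
    \<comment> \<open>Comparing the bounds leaves \<open>3 \<le> 2 * m\<close> up to the correction
      terms. For \<open>m = 0\<close> the allowance at order 3 pays for it; for \<open>m = 1\<close>
      there are no arcs inside \<open>?W\<close>, and four arcs just meet the bound.\<close>
    ultimately show ?thesis by (cases "m = 0 \<or> m = 1") (auto split: if_splits)
  qed
qed

text \<open>Order at least 7 means \<open>m \<ge> 4\<close>, so the exceptional order 3 does not
  occur for the rest, and \<open>4 * (m + 3) + m * m\<close> falls below
  \<open>(m + 3) * (m + 3) - 3\<close>, the least value that four times the rounded quotient can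
  take.\<close>

lemma no_triangle_if_extremal:
  assumes "finite V" "A \<subseteq> V \<times> V" "two_geo A"
    and n: "card V \<ge> 7" and eq: "card A = (card V)\<^sup>2 div 4"
  shows "\<not> directed_triangle A x y z"
proof
  assume tri: "directed_triangle A x y z"
  let ?W = "V - {x, y, z}"
  note rem = card_arcs_remove_triangle[OF assms(1-3) tri]
  define m where "m = card ?W"
  have "4 * card (A \<inter> ?W \<times> ?W) \<le> m\<^sup>2 + (if m = 3 then 3 else 0)"
    unfolding m_def using assms(1-3)
    by (intro card_arcs_le) (auto intro: two_geo_subset)
  moreover have V: "card V = m + 3" using rem(1) m_def by simp
  moreover have "card A \<le> m + 3 + card (A \<inter> ?W \<times> ?W)" using rem(2) V by simp
  moreover have "(m + 3)\<^sup>2 = m\<^sup>2 + 6 * m + 9" by (simp add: power2_eq_square algebra_simps)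
  ultimately show False using n eq by (auto split: if_splits)
qed


section \<open>Orientations of complete bipartite graphs\<close>

text \<open>Read the orientation as a 0/1 matrix with rows \<open>X\<close> and columns \<open>Y\<close>. Two rows cannot differ in
  the same sense at two columns, nor two columns at two rows, and this forces the 0s or the 1s
  to form a matching.\<close>

lemma bipartite_orientation:
  assumes geo: "two_geo A" and fin: "finite X" "finite Y"
    and X: "card X \<ge> 3" and Y: "card Y \<ge> 4"
    and E: "A \<union> A\<inverse> = X \<times> Y \<union> Y \<times> X"
  shows "single_valued (A \<inter> Y \<times> X) \<and> single_valued ((A \<inter> Y \<times> X)\<inverse>)
    \<or> single_valued (A \<inter> X \<times> Y) \<and> single_valued ((A \<inter> X \<times> Y)\<inverse>)"
proof -
  have or: "(y, x) \<in> A \<longleftrightarrow> (x, y) \<notin> A" if "x \<in> X" "y \<in> Y" for x y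
    using E that two_geo_antisym[OF geo, of x y] by blast
  \<comment> \<open>A 1 at \<open>(x, y)\<close> is an arc from \<open>x\<close> to
    \<open>y\<close>, a 0 is the opposite arc. A violation of \<open>row\<close> gives two 2-walks
    from \<open>x\<close> to \<open>x'\<close>, a violation of \<open>col\<close> two from
    \<open>y\<close> to \<open>y'\<close>.\<close>
  have row: "y = y'" if "x \<in> X" "x' \<in> X" "y \<in> Y" "y' \<in> Y"
      "(x, y) \<in> A" "(x, y') \<in> A" "(x', y) \<notin> A" "(x', y') \<notin> A" for x x' y y'
    using two_geo_unique[OF geo, of x y x' y'] or that by blast
  have col: "x = x'" if "x \<in> X" "x' \<in> X" "y \<in> Y" "y' \<in> Y"
      "(x, y) \<notin> A" "(x', y) \<notin> A" "(x, y') \<in> A" "(x', y') \<in> A" for x x' y y'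
    using two_geo_unique[OF geo, of y x y' x'] or that by blast
  define I where "I x = {y \<in> Y. (x, y) \<in> A}" for x
  define Z where "Z x = {y \<in> Y. (x, y) \<notin> A}" for x
  have finIZ: "finite (I x)" "finite (Z x)" for x using fin by (auto simp: I_def Z_def)
  have IZ: "Y = I x \<union> Z x" "I x \<inter> Z x = {}" for x by (auto simp: I_def Z_def)
  have cIZ: "card Y = card (I x) + card (Z x)" for x
    using IZ finIZ card_Un_disjoint by metis
  have two: "\<exists>a b. a \<in> B \<and> b \<in> B \<and> a \<noteq> b" if "\<not> card B \<le> 1" for B :: "'a set"
    using that by (metis card_le_Suc0_iff_eq card.infinite One_nat_def le0)
  \<comment> \<open>If row \<open>x\<close> had two 1s and two 0s, then by \<open>row\<close> any
    other row would share one of these 1s and one of these 0s, against \<open>col\<close>.\<close>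
  have type: "card (I x) \<le> 1 \<or> card (Z x) \<le> 1" if x: "x \<in> X" for x
  proof (rule ccontr)
    assume "\<not> ?thesis"
    then obtain a b c d where abcd: "a \<in> I x" "b \<in> I x" "a \<noteq> b" "c \<in> Z x" "d \<in> Z x" "c \<noteq> d"
      using two by metis
    have "\<not> X \<subseteq> {x}" using X card_mono[of "{x}" X] by auto
    then obtain x' where x': "x' \<in> X" "x' \<noteq> x" by blast
    from abcd row[OF x x'(1)] row[OF x'(1) x]
    have "(x', a) \<in> A \<or> (x', b) \<in> A" "(x', c) \<notin> A \<or> (x', d) \<notin> A"
      unfolding I_def Z_def by blast+
    then show False using abcd x x' col unfolding I_def Z_def mem_Collect_eq by metis
  qed
  \<comment> \<open>With at least four columns, a row with at most one 1 and a row with at most one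
    0 differ in the same sense at two or more columns, against \<open>row\<close>.\<close>
  have same: False if x: "x \<in> X" "x' \<in> X" "card (I x) \<le> 1" "card (Z x') \<le> 1" for x x'
  proof -
    have "card (Z x \<inter> I x') \<ge> 2"
    proof -
      have "Y \<subseteq> (Z x \<inter> I x') \<union> I x \<union> Z x'" using IZ[of x] IZ[of x'] by blast
      then have "card Y \<le> card ((Z x \<inter> I x') \<union> I x \<union> Z x')" using finIZ by (intro card_mono) auto
      also have "\<dots> \<le> card (Z x \<inter> I x') + card (I x) + card (Z x')"
        by (meson add_le_mono1 card_Un_le order_trans)
      finally show ?thesis using x Y by simp
    qed
    then have "\<not> card (Z x \<inter> I x') \<le> 1" by simp
    then show False using two[of "Z x \<inter> I x'"] row[of x' x] x by (auto simp: I_def Z_def)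
  qed
  have avoid: "\<exists>y \<in> Y. y \<notin> B \<union> C"
    if "card B \<le> 1" "card C \<le> 1" "finite B" "finite C" for B C
  proof (rule ccontr)
    assume "\<not> ?thesis"
    then have "Y \<subseteq> B \<union> C" by blast
    then have "card Y \<le> card (B \<union> C)" using that by (intro card_mono) auto
    also have "\<dots> \<le> card B + card C" by (rule card_Un_le)
    finally show False using that Y by simp
  qed
  from type same consider "\<And>x. x \<in> X \<Longrightarrow> card (Z x) \<le> 1" | "\<And>x. x \<in> X \<Longrightarrow> card (I x) \<le> 1"
    by blast
  then show ?thesis
  proof cases
    case 1
    have "y = y'" if "x \<in> X" "y \<in> Z x" "y' \<in> Z x" for x y y'
      using 1[OF that(1)] that finIZ by (metis One_nat_def card_le_Suc0_iff_eq)
    then have "single_valued ((A \<inter> Y \<times> X)\<inverse>)"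
      using or by (auto simp: single_valued_def Z_def)
    moreover have "x = x'" if xy: "x \<in> X" "x' \<in> X" "y \<in> Z x" "y \<in> Z x'" for x x' y
    proof -
      \<comment> \<open>If rows \<open>x\<close> and \<open>x'\<close> shared a 0 at
        \<open>y\<close>, this column, where both have a 1, would let \<open>col\<close> identify
        them.\<close>
      obtain y' where "y' \<in> Y" "y' \<notin> Z x \<union> Z x'"
        using avoid[OF 1[OF xy(1)] 1[OF xy(2)] finIZ(2) finIZ(2)] by blast
      then show ?thesis using col[of x x' y y'] xy by (auto simp: Z_def)
    qed
    then have "single_valued (A \<inter> Y \<times> X)"
      using or by (auto simp: single_valued_def Z_def)
    ultimately show ?thesis by blast
  next
    case 2
    have "y = y'" if "x \<in> X" "y \<in> I x" "y' \<in> I x" for x y y'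
      using 2[OF that(1)] that finIZ by (metis One_nat_def card_le_Suc0_iff_eq)
    then have "single_valued (A \<inter> X \<times> Y)"
      by (auto simp: single_valued_def I_def)
    moreover have "x = x'" if xy: "x \<in> X" "x' \<in> X" "y \<in> I x" "y \<in> I x'" for x x' y
    proof -
      obtain y' where "y' \<in> Y" "y' \<notin> I x \<union> I x'"
        using avoid[OF 2[OF xy(1)] 2[OF xy(2)] finIZ(1) finIZ(1)] by blast
      then show ?thesis using col[of x x' y' y] xy by (auto simp: I_def)
    qed
    then have "single_valued ((A \<inter> X \<times> Y)\<inverse>)"
      by (auto simp: single_valued_def I_def)
    ultimately show ?thesis by blast
  qed
qed

section \<open>Part sizes and the structure of extremal arc sets\<close>

lemma sq_div_4: "n\<^sup>2 div 4 = (n div 2) * (n - n div 2)" for n :: nat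
proof (cases "even n")
  case True
  then obtain k where "n = 2 * k" by (rule evenE)
  then show ?thesis by (simp add: power2_eq_square)
next
  case False
  then obtain k where k: "n = 2 * k + 1" by (rule oddE)
  have "n\<^sup>2 = 4 * (k * (k + 1)) + 1" by (simp add: k power2_eq_square algebra_simps)
  then have "n\<^sup>2 div 4 = k * (k + 1)" by simp
  then show ?thesis by (simp add: k)
qed

text \<open>The sum and product agree with those of the two halves \<open>h\<close> and
  \<open>k\<close>, so \<open>a\<close> is a root of the quadratic with roots \<open>h\<close> and
  \<open>k\<close>.\<close>

lemma balanced_if_product_maximal:
  fixes a b :: nat
  assumes "a + b = n" "a * b = n\<^sup>2 div 4"
  shows "a = n div 2 \<and> b = n - n div 2 \<or> a = n - n div 2 \<and> b = n div 2"
proof -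
  define h where "h = n div 2"
  define k where "k = n - n div 2"
  have hk: "h + k = n" "h \<le> k" "k \<le> h + 1" by (auto simp: h_def k_def)
  have "int a * int b = int h * int k"
    using assms(2) sq_div_4[of n] unfolding h_def k_def by (metis of_nat_mult)
  moreover have "int b = int h + int k - int a" using hk assms by linarith
  ultimately have "(int a - int h) * (int a - int k) = 0"
    by (simp add: algebra_simps)
  then have "a = h \<or> a = k" by auto
  then show ?thesis using hk assms(1) unfolding h_def k_def by linarith
qed

lemma extremal_structure:
  assumes fin: "finite V" and sub: "A \<subseteq> V \<times> V" and geo: "two_geo A"
    and n: "card V = n" "n \<ge> 7" and eq: "card A = n\<^sup>2 div 4"
  obtains S T where "V = S \<union> T" "S \<inter> T = {}" "card S \<in> {n div 2, n - n div 2}"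
    "A \<union> A\<inverse> = S \<times> T \<union> T \<times> S" "single_valued (A \<inter> T \<times> S)" "single_valued ((A \<inter> T \<times> S)\<inverse>)"
proof -
  have "\<not> directed_triangle A x y z" for x y z
    using no_triangle_if_extremal[OF fin sub geo] n eq by simp
  then obtain X Y where XY: "V = X \<union> Y" "X \<inter> Y = {}" "card X * card Y = card A"
      "A \<union> A\<inverse> = X \<times> Y \<union> Y \<times> X"
    using mantel(2)[OF fin sub geo] n eq by auto
  have finXY: "finite X" "finite Y" using XY fin by auto
  have "card X + card Y = n" using XY n finXY by (simp add: card_Un_disjoint)
  then have bal: "card X = n div 2 \<and> card Y = n - n div 2 \<or> card X = n - n div 2 \<and> card Y = n div 2"
    using XY(3) eq by (intro balanced_if_product_maximal) simp_all
  have "single_valued (A \<inter> Y \<times> X) \<and> single_valued ((A \<inter> Y \<times> X)\<inverse>)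
    \<or> single_valued (A \<inter> X \<times> Y) \<and> single_valued ((A \<inter> X \<times> Y)\<inverse>)"
  \<comment> \<open>The columns must be a part with at least four vertices; for
    \<open>n \<ge> 7\<close> the larger part qualifies and the other has at least three.\<close>
  proof (cases "card Y \<ge> 4")
    case True
    then have "card X \<ge> 3" using bal n by linarith
    then show ?thesis using bipartite_orientation[OF geo finXY _ True XY(4)] by blast
  next
    case False
    then have "card Y \<ge> 3" "card X \<ge> 4" using bal n by linarith+
    moreover have "A \<union> A\<inverse> = Y \<times> X \<union> X \<times> Y" using XY(4) by blast
    ultimately show ?thesis
      using bipartite_orientation[OF geo finXY(2,1)] by blast
  qed
  then show thesis
  proof
    assume "single_valued (A \<inter> Y \<times> X) \<and> single_valued ((A \<inter> Y \<times> X)\<inverse>)"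
    then show thesis using that[of X Y] XY bal by blast
  next
    assume "single_valued (A \<inter> X \<times> Y) \<and> single_valued ((A \<inter> X \<times> Y)\<inverse>)"
    moreover have "V = Y \<union> X" "Y \<inter> X = {}" "A \<union> A\<inverse> = Y \<times> X \<union> X \<times> Y" using XY by blast+
    ultimately show thesis using that[of Y X] bal by blast
  qed
qed

section \<open>Canonical representatives and isomorphism classes\<close>

text \<open>The parts are \<open>{..<s}\<close> and \<open>{s..<n}\<close>; the reversed arcs are those joining \<open>i\<close> and
  \<open>s + i\<close> for \<open>i < j\<close>.\<close>

definition canonical_digraph :: "nat \<Rightarrow> nat \<Rightarrow> nat \<Rightarrow> nat pair_pre_digraph" where
  "canonical_digraph n s j = \<lparr>pverts = {..<n},
     parcs = {(u, v). u < s \<and> s \<le> v \<and> v < n \<and> \<not> (u < j \<and> v = s + u)} \<union> {(u, v). v < j \<and> u = s + v}\<rparr>"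

context
  fixes n s j :: nat
  assumes j: "j \<le> s" "j \<le> n - s" and s: "s \<le> n"
begin

lemma pair_digraph_canonical: "pair_digraph (canonical_digraph n s j)"
proof -
  have "parcs (canonical_digraph n s j) \<subseteq> {..<n} \<times> {..<n}"
    using j s by (auto simp: canonical_digraph_def)
  moreover from this have "finite (parcs (canonical_digraph n s j))" by (rule finite_subset) simp
  ultimately show ?thesis
    by unfold_locales (use j s in \<open>auto simp: canonical_digraph_def\<close>)
qed

text \<open>A 2-walk has both ends in the same part and exactly one reversed arc, and the matching
  determines its middle vertex from the ends.\<close>

lemma two_geo_canonical: "two_geo (parcs (canonical_digraph n s j))"
  unfolding two_geo_def irrefl_def canonical_digraph_def using j s by auto

lemma card_parcs_canonical: "card (parcs (canonical_digraph n s j)) = s * (n - s)"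
proof -
  let ?M = "(\<lambda>i. (i, s + i)) ` {..<j}"
  let ?K = "{..<s} \<times> {s..<n}"
  have sub: "?M \<subseteq> ?K" using j s by auto
  have "parcs (canonical_digraph n s j) = (?K - ?M) \<union> ?M\<inverse>"
    by (auto simp: canonical_digraph_def)
  moreover have "(?K - ?M) \<inter> ?M\<inverse> = {}" using j s by auto
  ultimately have "card (parcs (canonical_digraph n s j)) = card (?K - ?M) + card (?M\<inverse>)"
    by (simp add: card_Un_disjoint)
  also have "\<dots> = card (?K - ?M) + card ?M" by (simp only: card_inverse)
  also have "\<dots> = card ?K" using sub card_Diff_subset[of ?M ?K] card_mono[of ?K ?M] by simp
  finally show ?thesis by simp
qed

end


section \<open>Isomorphisms with and between canonical digraphs\<close>

lemma digraph_iso_with_projI: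
  assumes "pair_wf_digraph G" "inj_on f (pverts G)" "pverts H = f ` pverts G"
    "parcs H = map_prod f f ` parcs G"
  shows "digraph_iso (with_proj G) (with_proj H)"
proof -
  interpret pair_wf_digraph G by fact
  let ?h = "\<lparr>iso_verts = f, iso_arcs = map_prod f f, iso_head = snd, iso_tail = fst\<rparr>"
  have "inj_on (map_prod f f) (parcs G)"
    using map_prod_inj_on[OF assms(2,2)] by (rule inj_on_subset) (auto dest: wellformed')
  then have "pre_digraph.digraph_isomorphism (with_proj G) ?h"
    using assms(2) wf_digraph_axioms by (auto simp: pre_digraph.digraph_isomorphism_def)
  moreover have "with_proj H = app_iso ?h (with_proj G)"
    using assms(3,4) by (simp add: with_proj_def app_iso_def)
  ultimately show ?thesis unfolding digraph_iso_def by blast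
qed

lemma digraph_iso_card_out_degree:
  assumes "digraph_iso G H"
  shows "card {v \<in> verts G. P (out_degree G v)} = card {v \<in> verts H. P (out_degree H v)}"
proof -
  obtain h where h: "pre_digraph.digraph_isomorphism G h" "H = app_iso h G"
    using assms unfolding digraph_iso_def by blast
  then have "wf_digraph G" by (simp add: pre_digraph.digraph_isomorphism_def)
  then have "{v \<in> verts H. P (out_degree H v)} = iso_verts h ` {v \<in> verts G. P (out_degree G v)}"
    using h by (auto simp: wf_digraph.out_degree_app_iso_eq)
  moreover have "inj_on (iso_verts h) {v \<in> verts G. P (out_degree G v)}"
    using pre_digraph.digraph_isomorphism_inj_on_verts[OF h(1)] by (rule inj_on_subset) auto
  ultimately show ?thesis by (simp add: card_image)
qed

text \<open>Extends a numbering of the matched vertices of a part to the whole part, keeping them in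
  the initial segment.\<close>

lemma bij_betw_extend_interval:
  fixes a b c :: nat
  assumes "finite S" "P \<subseteq> S" "bij_betw g P {a..<b}" "card S = c - a" "a \<le> b" "b \<le> c"
  shows "\<exists>f. bij_betw f S {a..<c} \<and> (\<forall>x\<in>P. f x = g x)"
proof -
  have "card P = b - a" using bij_betw_same_card[OF assms(3)] by simp
  then have "card (S - P) = card {b..<c}"
    using assms by (simp add: card_Diff_subset finite_subset)
  then obtain h where h: "bij_betw h (S - P) {b..<c}"
    using assms(1) finite_same_card_bij[of "S - P" "{b..<c}"] by auto
  define f where "f x = (if x \<in> P then g x else h x)" for x
  have "bij_betw f P {a..<b}" using assms(3) by (subst bij_betw_cong[of _ _ g]) (auto simp: f_def)
  moreover have "bij_betw f (S - P) {b..<c}" using h by (subst bij_betw_cong[of _ _ h]) (auto simp: f_def)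
  ultimately have "bij_betw f (P \<union> (S - P)) ({a..<b} \<union> {b..<c})"
    by (rule bij_betw_combine) auto
  moreover have "P \<union> (S - P) = S" "{a..<b} \<union> {b..<c} = {a..<c}" using assms by auto
  ultimately show ?thesis by (auto simp: f_def)
qed

text \<open>Number the matched vertices of \<open>S\<close> first, give each partner in
  \<open>T\<close> the same number shifted by \<open>s\<close>, and number the rest arbitrarily.
  Each pair across the parts carries exactly one arc, so matching the reversed arcs
  suffices.\<close>

lemma iso_canonical_digraph:
  assumes G: "pair_digraph G" and geo: "two_geo (parcs G)" and n: "card (pverts G) = n"
    and V: "pverts G = S \<union> T" "S \<inter> T = {}"
    and E: "parcs G \<union> (parcs G)\<inverse> = S \<times> T \<union> T \<times> S"
    and M: "single_valued (parcs G \<inter> T \<times> S)" "single_valued ((parcs G \<inter> T \<times> S)\<inverse>)"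
  shows "\<exists>j. j \<le> card S \<and> j \<le> n - card S
    \<and> digraph_iso (with_proj G) (with_proj (canonical_digraph n (card S) j))"
proof -
  interpret pair_digraph G by fact
  define A where "A = parcs G"
  define M where "M = A \<inter> T \<times> S"
  define s where "s = card S"
  define j where "j = card (Range M)"
  have fin: "finite S" "finite T" using pair_finite_verts V by auto
  have cT: "card T = n - s" "s \<le> n" using V fin n by (auto simp: s_def card_Un_disjoint)
  have sub: "Range M \<subseteq> S" "Domain M \<subseteq> T" by (auto simp: M_def)
  \<comment> \<open>The partner of \<open>t\<close> in \<open>S\<close>, arbitrary outside
    \<open>Domain M\<close>; by \<open>M(1)\<close> the relation \<open>M\<close> is the graph of
    \<open>m\<close> on its domain.\<close>
  define m where "m t = (SOME p. (t, p) \<in> M)" for t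
  have m: "(t, p) \<in> M \<longleftrightarrow> t \<in> Domain M \<and> p = m t" for t p
    using M(1) someI[of "\<lambda>p. (t, p) \<in> M"] unfolding A_def[symmetric] M_def[symmetric] m_def single_valued_def
    by (metis DomainE DomainI)
  have "inj_on m (Domain M)"
    using M(2) m unfolding A_def[symmetric] M_def[symmetric] single_valued_def
    by (intro inj_onI) (metis converseI)
  moreover have "m ` Domain M = Range M" using m by blast
  ultimately have bm: "bij_betw m (Domain M) (Range M)" by (simp add: bij_betw_def)
  have jD: "card (Domain M) = j" using bij_betw_same_card[OF bm] by (simp add: j_def)
  have js: "j \<le> s" unfolding j_def s_def using fin sub by (simp add: card_mono)
  have jt: "j \<le> n - s" using jD cT fin sub card_mono by metis
  have "finite (Range M)" using fin sub finite_subset by blast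
  then have "\<exists>g. bij_betw g (Range M) {0..<j}"
    by (rule finite_same_card_bij) (simp_all add: j_def)
  then obtain g where g: "bij_betw g (Range M) {0..<j}" by blast
  then obtain fS where fS: "bij_betw fS S {0..<s}" and fSg: "\<forall>x\<in>Range M. fS x = g x"
    using bij_betw_extend_interval[OF fin(1) sub(1) g, of s] js s_def by auto
  have fSM: "bij_betw fS (Range M) {0..<j}"
    using g fSg by (simp cong: bij_betw_cong)
  have sh: "bij_betw (\<lambda>i. s + i) {0..<j} {s..<s + j}"
    by (rule bij_betwI[where g = "\<lambda>i. i - s"]) auto
  have bD: "bij_betw (\<lambda>t. s + fS (m t)) (Domain M) {s..<s + j}"
    using bij_betw_trans[OF bij_betw_trans[OF bm fSM] sh] by (simp add: o_def)
  have sjn: "s + j \<le> n" using jt cT(2) by linarith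
  obtain fT where fT: "bij_betw fT T {s..<n}" and fTM: "\<forall>t\<in>Domain M. fT t = s + fS (m t)"
    using bij_betw_extend_interval[OF fin(2) sub(2) bD cT(1) le_add1 sjn] by blast
  define f where "f v = (if v \<in> S then fS v else fT v)" for v
  have fST: "f x = fS x" if "x \<in> S" for x using that by (simp add: f_def)
  have fTT: "f y = fT y" if "y \<in> T" for y using that V(2) by (auto simp: f_def)
  have bS: "bij_betw f S {0..<s}" using fS fST by (simp cong: bij_betw_cong)
  have bT: "bij_betw f T {s..<n}" using fT fTT by (simp cong: bij_betw_cong)
  have bV: "bij_betw f (S \<union> T) {..<n}"
  proof -
    have "{0..<s} \<union> {s..<n} = {..<n}" using cT by auto
    then show ?thesis using bij_betw_combine[OF bS bT] by auto
  qed
  have rng: "f x < s" "s \<le> f y" "f y < n" if "x \<in> S" "y \<in> T" for x y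
    using that bS bT bij_betwE by fastforce+
  have key: "(y, x) \<in> A \<longleftrightarrow> f x < j \<and> f y = s + f x" if x: "x \<in> S" and y: "y \<in> T" for x y
  proof
    assume "(y, x) \<in> A"
    then have yx: "(y, x) \<in> M" using x y by (simp add: M_def)
    then have "fS x < j" using bij_betwE[OF fSM] by auto
    moreover have "y \<in> Domain M" "x = m y" using yx m by auto
    ultimately show "f x < j \<and> f y = s + f x" using fTM fST[OF x] fTT[OF y] by simp
  next
    assume *: "f x < j \<and> f y = s + f x"
    then have "fS x \<in> fS ` Range M" using fSM fST[OF x] by (simp add: bij_betw_def)
    then have "x \<in> Range M" using fS x sub(1) by (auto simp: bij_betw_def dest: inj_onD)
    then obtain y' where y': "(y', x) \<in> M" by blast
    then have "y' \<in> T" "fT y' = s + fS x" using fTM m[of y' x] by (auto simp: M_def)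
    then have "fT y' = fT y" using * fST[OF x] fTT[OF y] by simp
    then have "y' = y" using fT \<open>y' \<in> T\<close> y by (auto simp: bij_betw_def dest: inj_onD)
    then show "(y, x) \<in> A" using y' by (simp add: M_def)
  qed
  have or: "(y, x) \<in> A \<longleftrightarrow> (x, y) \<notin> A" if "x \<in> S" "y \<in> T" for x y
    using E that two_geo_antisym[OF geo, of x y] unfolding A_def by blast
  have AST: "(u, v) \<in> S \<times> T \<union> T \<times> S" if "(u, v) \<in> A" for u v using E that unfolding A_def by blast
  have "parcs (canonical_digraph n s j) = map_prod f f ` A"
  proof (intro equalityI subsetI)
    fix e assume e: "e \<in> parcs (canonical_digraph n s j)"
    obtain a b where ab: "e = (a, b)" by (cases e)
    from e ab consider "a < s" "s \<le> b" "b < n" "\<not> (a < j \<and> b = s + a)" | "b < j" "a = s + b"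
      unfolding canonical_digraph_def by auto
    then show "e \<in> map_prod f f ` A"
    proof cases
      case 1
      then have "a \<in> f ` S" "b \<in> f ` T" using bS bT by (auto simp: bij_betw_def)
      then obtain x y where xy: "x \<in> S" "y \<in> T" "a = f x" "b = f y" by blast
      then have "(x, y) \<in> A" using 1 key[OF xy(1,2)] or[OF xy(1,2)] xy(3,4) by auto
      then show ?thesis using ab xy by (metis image_eqI map_prod_simp)
    next
      case 2
      then have "b \<in> f ` S" "a \<in> f ` T" using bS bT js jt by (auto simp: bij_betw_def)
      then obtain x y where xy: "x \<in> S" "y \<in> T" "b = f x" "a = f y" by blast
      then have "(y, x) \<in> A" using 2 key[OF xy(1,2)] xy(3,4) by simp
      then show ?thesis using ab xy by (metis image_eqI map_prod_simp)
    qed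
  next
    fix e assume "e \<in> map_prod f f ` A"
    then obtain u v where uv: "(u, v) \<in> A" "e = (f u, f v)" by auto
    from AST[OF uv(1)] consider "u \<in> S" "v \<in> T" | "u \<in> T" "v \<in> S" by blast
    then show "e \<in> parcs (canonical_digraph n s j)"
    proof cases
      case 1
      then show ?thesis using uv or[OF 1] key[OF 1] rng[OF 1] by (auto simp: canonical_digraph_def)
    next
      case 2
      then show ?thesis using uv key[OF 2(2,1)] by (simp add: canonical_digraph_def)
    qed
  qed
  moreover have "pverts (canonical_digraph n s j) = f ` pverts G" "inj_on f (pverts G)"
    using bV V by (auto simp: bij_betw_def canonical_digraph_def)
  ultimately have "digraph_iso (with_proj G) (with_proj (canonical_digraph n s j))"
    using pair_wf_digraph_axioms by (intro digraph_iso_with_projI) (auto simp: A_def)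
  then show ?thesis using js jt unfolding s_def by blast
qed

text \<open>Since the part \<open>{s..<n}\<close> has at least three vertices, \<open>s\<close> and \<open>j\<close> can be read off from the
  out-degrees.\<close>

lemma canonical_digraph_iso_imp_eq:
  assumes "digraph_iso (with_proj (canonical_digraph n s j)) (with_proj (canonical_digraph n s' j'))"
    and "j \<le> s" "j \<le> n - s" "s + 3 \<le> n" and "j' \<le> s'" "j' \<le> n - s'" "s' + 3 \<le> n"
  shows "s = s' \<and> j = j'"
proof -
  have *: "card {v \<in> verts (with_proj (canonical_digraph n s j)).
        2 \<le> out_degree (with_proj (canonical_digraph n s j)) v} = s"
      "card {v \<in> verts (with_proj (canonical_digraph n s j)).
        out_degree (with_proj (canonical_digraph n s j)) v = 1} = j"
    if j: "j \<le> s" "j \<le> n - s" and s: "s + 3 \<le> n" for s j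
  proof -
    let ?C = "with_proj (canonical_digraph n s j)"
    interpret pair_digraph "canonical_digraph n s j"
      using j s by (intro pair_digraph_canonical) auto
    have big: "2 \<le> out_degree ?C u" if "u < s" for u
    proof -
      \<comment> \<open>Only the arc to \<open>s + u\<close> can be reversed. Leaving it out for
        every \<open>u\<close> still keeps at least two of the three or more vertices of the other
        part.\<close>
      have "Pair u ` ({s..<n} - {s + u}) \<subseteq> out_arcs ?C u"
        using that by (auto simp: out_arcs_def canonical_digraph_def)
      then have "card (Pair u ` ({s..<n} - {s + u})) \<le> out_degree ?C u"
        unfolding out_degree_def using finite_out_arcs by (intro card_mono)
      moreover have "card (Pair u ` ({s..<n} - {s + u})) = card ({s..<n} - {s + u})"
        by (intro card_image inj_onI) auto
      moreover have "card {s..<n} - card {s + u} \<le> card ({s..<n} - {s + u})"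
        by (rule diff_card_le_card_Diff) simp
      ultimately show ?thesis using s by simp
    qed
    have one: "out_degree ?C u = 1" if "s \<le> u" "u < s + j" for u
    proof -
      have "out_arcs ?C u = {(u, u - s)}"
        using that j by (auto simp: out_arcs_def canonical_digraph_def)
      then show ?thesis by (simp add: out_degree_def)
    qed
    have zero: "out_degree ?C u = 0" if "s + j \<le> u" for u
    proof -
      have "out_arcs ?C u = {}"
        using that j by (auto simp: out_arcs_def canonical_digraph_def)
      then show ?thesis by (simp add: out_degree_def)
    qed
    have deg: "2 \<le> out_degree ?C u \<longleftrightarrow> u < s" "out_degree ?C u = 1 \<longleftrightarrow> s \<le> u \<and> u < s + j" for u
      using big[of u] one[of u] zero[of u] by linarith+
    have vC: "verts ?C = {..<n}" by (simp add: canonical_digraph_def)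
    have "{v \<in> verts ?C. 2 \<le> out_degree ?C v} = {..<s}" "{v \<in> verts ?C. out_degree ?C v = 1} = {s..<s + j}"
      unfolding deg vC using j s by auto
    then show "card {v \<in> verts ?C. 2 \<le> out_degree ?C v} = s" "card {v \<in> verts ?C. out_degree ?C v = 1} = j"
      by simp_all
  qed
  show ?thesis
    using *[OF assms(2-4)] *[OF assms(5-7)] digraph_iso_card_out_degree[OF assms(1), of "\<lambda>d. 2 \<le> d"]
      digraph_iso_card_out_degree[OF assms(1), of "\<lambda>d. d = 1"] by simp
qed

lemma unidirectional_canonical:
  assumes s: "s \<in> {a, b}" "a + b = n" and j: "j \<le> a" "j \<le> b"
  shows "unidirectional_up_to_matching a b (canonical_digraph n s j)"
proof -
  let ?S = "{..<s}" and ?T = "{s..<n}"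
  let ?K = "\<lparr>pverts = {..<n}, parcs = ?S \<times> ?T \<union> ?T \<times> ?S\<rparr>"
  let ?M = "{(u, v). v < j \<and> u = s + v}"
  have sn: "s \<le> n" "j \<le> s" "j \<le> n - s" using assms by auto
  \<comment> \<open>Either part may be the source, so \<open>a\<close> is the size of
    \<open>?S\<close> or of \<open>?T\<close> depending on \<open>s\<close>.\<close>
  have "card ?S = a \<and> card ?T = b \<or> card ?T = a \<and> card ?S = b" using s by auto
  moreover have "{..<n} = ?S \<union> ?T" "{..<n} = ?T \<union> ?S" "?S \<inter> ?T = {}" "?T \<inter> ?S = {}" using sn by auto
  ultimately have "complete_bipartite_digraph a b (with_proj ?K)"
    unfolding complete_bipartite_digraph_pair_def
    by (auto simp only: pair_pre_digraph.select_convs finite_lessThan Un_commute)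
  moreover have "orientation (canonical_digraph n s j) ?K"
    unfolding orientation_def canonical_digraph_def using sn by auto
  moreover have "partite_sets ?S ?T ?K" using sn by (auto simp: partite_sets_def)
  moreover have "?M \<subseteq> parcs (canonical_digraph n s j)" by (auto simp: canonical_digraph_def)
  moreover have "arc_matching ?M"
    using sn by (auto simp: arc_matching_def pairwise_def)
  moreover have "?M \<subseteq> ?T \<times> ?S" using sn by auto
  moreover have "parcs (canonical_digraph n s j) - ?M \<subseteq> ?S \<times> ?T" by (auto simp: canonical_digraph_def)
  ultimately show ?thesis unfolding unidirectional_up_to_matching_def by blast
qed

section \<open>The extremal number and the count of isomorphism classes\<close>

lemma ex_geodetic_2:
  assumes n: "n \<ge> 7"
  shows "ex_geodetic n 2 = n\<^sup>2 div 4"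
  unfolding ex_geodetic_def
proof (rule Max_eqI)
  \<comment> \<open>The balanced complete bipartite graph with all arcs in one direction attains the
    bound.\<close>
  let ?C = "canonical_digraph n (n div 2) 0"
  have C: "pair_digraph ?C" "two_geo (parcs ?C)" "card (parcs ?C) = n\<^sup>2 div 4"
    using pair_digraph_canonical[of 0 "n div 2" n] two_geo_canonical[of 0 "n div 2" n]
      card_parcs_canonical[of 0 "n div 2" n] by (simp_all add: sq_div_4)
  then have "k_geodetic 2 ?C" by (simp add: k_geodetic_2_iff)
  moreover have "card (pverts ?C) = n" by (simp add: canonical_digraph_def)
  ultimately show "n\<^sup>2 div 4 \<in> {card (parcs G) |G :: nat pair_pre_digraph.
      pair_digraph G \<and> card (pverts G) = n \<and> k_geodetic 2 G}"
    using C by (metis (mono_tags, lifting) mem_Collect_eq)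
next
  fix y assume "y \<in> {card (parcs G) |G :: nat pair_pre_digraph.
      pair_digraph G \<and> card (pverts G) = n \<and> k_geodetic 2 G}"
  then obtain G :: "nat pair_pre_digraph" where G: "y = card (parcs G)" "pair_digraph G"
      "card (pverts G) = n" "k_geodetic 2 G" by blast
  interpret pair_digraph G by fact
  have "4 * card (parcs G) \<le> n\<^sup>2"
    using card_arcs_le[of "pverts G" "parcs G"] G n pair_finite_verts
    by (force simp: k_geodetic_2_iff dest: wellformed')
  then show "y \<le> n\<^sup>2 div 4" using G by simp
qed (rule ex_geodetic_set_finite_nonempty)

lemma extremal_iso_canonical:
  assumes n: "n \<ge> 7" and G: "extremal_geodetic n 2 G"
  shows "\<exists>s \<in> {n div 2, n - n div 2}. \<exists>j \<le> n div 2.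
    digraph_iso (with_proj G) (with_proj (canonical_digraph n s j))"
proof -
  have *: "pair_digraph G" "card (pverts G) = n" "two_geo (parcs G)" "card (parcs G) = n\<^sup>2 div 4"
    using G ex_geodetic_2[OF n] by (auto simp: extremal_geodetic_def k_geodetic_2_iff)
  interpret pair_digraph G by fact
  have "parcs G \<subseteq> pverts G \<times> pverts G" by (auto dest: wellformed')
  then obtain S T where "pverts G = S \<union> T" "S \<inter> T = {}" and S: "card S \<in> {n div 2, n - n div 2}"
    and "parcs G \<union> (parcs G)\<inverse> = S \<times> T \<union> T \<times> S"
      "single_valued (parcs G \<inter> T \<times> S)" "single_valued ((parcs G \<inter> T \<times> S)\<inverse>)"
    using extremal_structure[OF pair_finite_verts _ *(3,2) n *(4)] by metis
  then obtain j where j: "j \<le> card S" "j \<le> n - card S"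
      "digraph_iso (with_proj G) (with_proj (canonical_digraph n (card S) j))"
    using iso_canonical_digraph[OF *(1,3,2)] by blast
  \<comment> \<open>The smaller of the two parts has \<open>n div 2\<close> vertices and bounds the
    matching.\<close>
  then have "j \<le> n div 2" using S by auto
  then show ?thesis using S j by blast
qed

lemma extremal_canonical:
  assumes n: "n \<ge> 7" and s: "s \<in> {n div 2, n - n div 2}" and j: "j \<le> n div 2"
  shows "extremal_geodetic n 2 (canonical_digraph n s j)"
proof -
  have "j \<le> s" "j \<le> n - s" "s \<le> n" and "s * (n - s) = n\<^sup>2 div 4"
    using s j by (auto simp: sq_div_4)
  then show ?thesis
    using pair_digraph_canonical[of j s n] two_geo_canonical[of j s n] card_parcs_canonical[of j s n]
      ex_geodetic_2[OF n]
    by (simp add: extremal_geodetic_def k_geodetic_2_iff) (simp add: canonical_digraph_def)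
qed

text \<open>The pairs \<open>(s, j)\<close> index the classes bijectively. Taking the cardinality of
  the set of sizes covers both parities, as the two sizes coincide for even
  \<open>n\<close>.\<close>

lemma card_iso_classes_extremal:
  assumes n: "n \<ge> 7"
  shows "card (iso_classes {G. extremal_geodetic n 2 G}) = card {n div 2, n - n div 2} * (n div 2 + 1)"
proof -
  let ?A = "{G :: nat pair_pre_digraph. extremal_geodetic n 2 G}"
  let ?R = "{(G, H). G \<in> ?A \<and> H \<in> ?A \<and> digraph_iso (with_proj G) (with_proj H)}"
  let ?P = "{n div 2, n - n div 2} \<times> {..n div 2}"
  let ?C = "\<lambda>(s, j). canonical_digraph n s j"
  have wf: "wf_digraph (with_proj G)" if "G \<in> ?A" for G
  proof -
    interpret pair_digraph G using that by (simp add: extremal_geodetic_def)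
    show ?thesis by (rule wf_digraph_axioms)
  qed
  have refl: "digraph_iso (with_proj G) (with_proj G)" if "G \<in> ?A" for G
  proof -
    interpret pair_digraph G using that by (simp add: extremal_geodetic_def)
    show ?thesis by (rule digraph_iso_with_projI[of _ id]) (auto simp: pair_wf_digraph_axioms map_prod.id)
  qed
  have equiv: "equiv ?A ?R"
  proof (rule equivI)
    show "?R \<subseteq> ?A \<times> ?A" by blast
    show "refl_on ?A ?R" using refl by (auto simp: refl_on_def)
    show "sym ?R" using wf digraph_iso_swap by (auto simp: sym_def)
    show "trans ?R" using digraph_iso_trans by (auto simp: trans_def)
  qed
  have CA: "?C p \<in> ?A" if "p \<in> ?P" for p using that extremal_canonical[OF n] by auto
  have "iso_classes ?A = (\<lambda>p. ?R `` {?C p}) ` ?P"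
  proof (intro equalityI subsetI)
    fix X assume "X \<in> iso_classes ?A"
    then obtain G where G: "G \<in> ?A" "X = ?R `` {G}" unfolding iso_classes_def by (rule quotientE)
    then obtain s j where "s \<in> {n div 2, n - n div 2}" "j \<le> n div 2"
        "digraph_iso (with_proj G) (with_proj (canonical_digraph n s j))"
      using extremal_iso_canonical[OF n, of G] by auto
    then have p: "(s, j) \<in> ?P" and GC: "(G, ?C (s, j)) \<in> ?R" using G CA[of "(s, j)"] by auto
    have "X = ?R `` {?C (s, j)}" unfolding G(2) by (rule equiv_class_eq[OF equiv GC])
    then show "X \<in> (\<lambda>p. ?R `` {?C p}) ` ?P" using p by (rule image_eqI[of X "\<lambda>p. ?R `` {?C p}"])
  next
    fix X assume "X \<in> (\<lambda>p. ?R `` {?C p}) ` ?P"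
    then obtain p where p: "X = ?R `` {?C p}" "p \<in> ?P" by (rule imageE)
    show "X \<in> iso_classes ?A" unfolding iso_classes_def p(1) by (rule quotientI[OF CA[OF p(2)]])
  qed
  moreover have "inj_on (\<lambda>p. ?R `` {?C p}) ?P"
  proof (rule inj_onI)
    fix p q assume pq: "p \<in> ?P" "q \<in> ?P" "?R `` {?C p} = ?R `` {?C q}"
    obtain s j s' j' where sj: "p = (s, j)" "q = (s', j')" by (cases p, cases q)
    have "(?C p, ?C q) \<in> ?R" by (rule eq_equiv_class[OF pq(3) equiv CA[OF pq(2)]])
    then have "digraph_iso (with_proj (canonical_digraph n s j)) (with_proj (canonical_digraph n s' j'))"
      using sj by simp
    \<comment> \<open>For \<open>n \<ge> 7\<close> even the smaller part has three vertices, as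
      reading off \<open>s\<close> and \<open>j\<close> from out-degrees requires.\<close>
    moreover have "j \<le> s" "j \<le> n - s" "s + 3 \<le> n" "j' \<le> s'" "j' \<le> n - s'" "s' + 3 \<le> n"
      using pq sj n by auto
    ultimately show "p = q" using canonical_digraph_iso_imp_eq sj by blast
  qed
  ultimately have "card (iso_classes ?A) = card ?P" by (simp add: card_image)
  then show ?thesis by (simp add: card_cartesian_product)
qed

theorem theorem13:
  fixes n :: nat
  assumes "n \<ge> 7"
  shows "(\<forall>G :: 'a pair_pre_digraph. extremal_geodetic n 2 G \<longrightarrow>
            (\<exists>H :: nat pair_pre_digraph. digraph_iso (with_proj G) (with_proj H) \<and>
               unidirectional_up_to_matching (nat \<lceil>real n / 2\<rceil>) (nat \<lfloor>real n / 2\<rfloor>) H))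
       \<and> (odd n \<longrightarrow> card (iso_classes {G. extremal_geodetic n 2 G}) = n + 1)
       \<and> (even n \<longrightarrow> card (iso_classes {G. extremal_geodetic n 2 G}) = n div 2 + 1)"
proof (intro conjI allI impI)
  fix G :: "'a pair_pre_digraph" assume "extremal_geodetic n 2 G"
  then obtain s j where s: "s \<in> {n div 2, n - n div 2}" and j: "j \<le> n div 2"
    and iso: "digraph_iso (with_proj G) (with_proj (canonical_digraph n s j))"
    using extremal_iso_canonical[OF assms] by blast
  have floor: "nat \<lfloor>real n / 2\<rfloor> = n div 2" by linarith
  have ceiling: "nat \<lceil>real n / 2\<rceil> = n - n div 2" by linarith
  have "unidirectional_up_to_matching (n - n div 2) (n div 2) (canonical_digraph n s j)"
    using s j by (intro unidirectional_canonical) auto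
  then show "\<exists>H :: nat pair_pre_digraph. digraph_iso (with_proj G) (with_proj H) \<and>
      unidirectional_up_to_matching (nat \<lceil>real n / 2\<rceil>) (nat \<lfloor>real n / 2\<rfloor>) H"
    using iso unfolding floor ceiling by blast
next
  assume "odd n"
  then have "n div 2 \<noteq> n - n div 2" "2 * (n div 2 + 1) = n + 1" by presburger+
  then show "card (iso_classes {G. extremal_geodetic n 2 G}) = n + 1"
    using card_iso_classes_extremal[OF assms] by simp
next
  assume "even n"
  then have "n - n div 2 = n div 2" by presburger
  then show "card (iso_classes {G. extremal_geodetic n 2 G}) = n div 2 + 1"
    using card_iso_classes_extremal[OF assms] by simp
qed

end
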